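(* Consider the zero divisor equation $(a+b)(c+d)=0$, where $a,b,c,d$ are distinct pure scaled basis elements of $\mathbb U_m$ with $a^2=b^2$ and $c^2=d^2$. Its parallel terms and cross terms separate into $$ac+bd=0\quad\text{and}\quad ad+bc=0,$$ with the second equation being an identity, thus reducing the definition of a zero divisor pair to just $ac=-bd$, as long as none of the terms form an associative algebra. Further, this is equivalent to Type 3 associativity, and it means that the number $Z_m$ of zero divisors for $\mathbb U_m$, where $n=m+3>0$ and $N_m=2^n-1$, is $$Z_m=\frac1{16}(N_m-1)(N_m-3)(N_m-7).$$
   Context: The real Cayley-Dickson algebras $\mathbb A_n$ are defined recursively by $\mathbb A_0=\mathbb R$ with trivial conjugation and $\mathbb A_n=\mathbb A_{n-1}\oplus\mathbb A_{n-1}$ with $(x,y)(z,w)=(xz-w^*y,\;wx+yz^* )$ and $(x,y)^*=(x^*,-y)$. Write $\mathbb U_m=\mathbb A_{m+3}$ (for $m\ge1$ these are the "ultronion" algebras, $\mathbb U_1$ being the sedenions; by convention $\mathbb U_0$ is the octonions). The graded basis of $\mathbb A_n$ is $\{\mathrm o_\alpha:\alpha\subseteq\{1,\dots,n\}\}$ with $\mathrm o_\emptyset=1$ and, for $\alpha\subseteq\{1,\dots,n-1\}$, $\mathrm o_\alpha=(\mathrm o_\alpha,0)$ and $\mathrm o_{\alpha\cup\{n\}}=(0,\mathrm o_\alpha)$. It is ordered by $1,\mathrm o_1,\mathrm o_2,\mathrm o_{12},\mathrm o_3,\mathrm o_{13},\dots$, i.e. the basis of $\mathbb A_{n-1}$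 followed by the same list multiplied by $\mathrm o_n$. Pure basis elements are those other than $1$; there are $N_m=2^{m+3}-1$ of them in $\mathbb U_m$. A pure scaled basis element (blade) is $\pm$ a pure basis element. The associator is $[x,y,z]=(xy)z-x(yz)$. For basis elements $b<c<d$ with $a=(bc)d$ non-scalar, Type 3 associativity means that the associators $[a,c,b]$, $[c,b,d]$, $[a,d,b]$, $[c,a,d]$ (which are either all zero or all non-zero) vanish. Three elements form an associative (quaternion-like) algebra when one is, up to sign, the product of the other two. A zero divisor pair is an equation $(a+b)(c+d)=0$ with $a,b,c,d$ distinct pure scaled basis elements, $a^2=b^2$ and $c^2=d^2$. The number $Z_m$ counts zero divisor pairs; the reversed product $(c+d)(a+b)$ and the products obtained by swapping the terms within brackets are regarded as the same zero divisor pair, and $b,c,d$ are taken to be positive basis elements. Linear combinations of zero divisor pairs are not considered.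
   Formalization: The second equation is an identity, and the reduction to ac=-bd holds, only when a=(bc)d, which is assumed there (and shown to hold for every zero divisor pair); a+b and c+d are required nonzero; for the count, terms are compared up to sign. *)

theory Defs
  imports Complex_Main
begin

text \<open>
  Elements of all Cayley--Dickson algebras live in one type of binary trees; the elements of the
  \<open>n\<close>-th algebra are the complete trees of depth \<open>n\<close>.
  Operations on trees of different shape return an irrelevant value.
\<close>

datatype cd = Scal real | Pair cd cd

fun cd_alg :: "nat \<Rightarrow> cd set" where
  "cd_alg 0 = range Scal"
| "cd_alg (Suc n) = {Pair x y | x y. x \<in> cd_alg n \<and> y \<in> cd_alg n}"

fun cd_zero :: "nat \<Rightarrow> cd" where
  "cd_zero 0 = Scal 0"
| "cd_zero (Suc n) = Pair (cd_zero n) (cd_zero n)"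

fun cd_neg :: "cd \<Rightarrow> cd" where
  "cd_neg (Scal r) = Scal (- r)"
| "cd_neg (Pair x y) = Pair (cd_neg x) (cd_neg y)"

fun cd_add :: "cd \<Rightarrow> cd \<Rightarrow> cd" where
  "cd_add (Scal r) (Scal s) = Scal (r + s)"
| "cd_add (Pair x y) (Pair z w) = Pair (cd_add x z) (cd_add y w)"
| "cd_add _ _ = Scal 0"

fun cd_conj :: "cd \<Rightarrow> cd" where
  "cd_conj (Scal r) = Scal r"
| "cd_conj (Pair x y) = Pair (cd_conj x) (cd_neg y)"

lemma size_cd_neg [simp]: "size (cd_neg x) = size x"
  by (induction x) auto

lemma size_cd_conj [simp]: "size (cd_conj x) = size x"
  by (induction x) auto

function cd_mul :: "cd \<Rightarrow> cd \<Rightarrow> cd" where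
  "cd_mul (Scal r) (Scal s) = Scal (r * s)"
| "cd_mul (Pair x y) (Pair z w) =
     Pair (cd_add (cd_mul x z) (cd_neg (cd_mul (cd_conj w) y)))
          (cd_add (cd_mul w x) (cd_mul y (cd_conj z)))"
| "cd_mul (Scal r) (Pair z w) = Scal 0"
| "cd_mul (Pair x y) (Scal s) = Scal 0"
  by pat_completeness auto
termination
  by (relation "measure (\<lambda>(x, y). size x + size y)") auto

instantiation cd :: "{plus, minus, uminus, times}"
begin

definition plus_cd :: "cd \<Rightarrow> cd \<Rightarrow> cd" where "x + y = cd_add x y"
definition uminus_cd :: "cd \<Rightarrow> cd" where "- x = cd_neg x"
definition minus_cd :: "cd \<Rightarrow> cd \<Rightarrow> cd" where "x - y = cd_add x (cd_neg y)"
definition times_cd :: "cd \<Rightarrow> cd \<Rightarrow> cd" where "x * y = cd_mul x y"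

instance ..

end

fun cd_basis :: "nat \<Rightarrow> nat set \<Rightarrow> cd" where
  "cd_basis 0 \<alpha> = Scal 1"
| "cd_basis (Suc n) \<alpha> =
     (if Suc n \<in> \<alpha> then Pair (cd_zero n) (cd_basis n (\<alpha> - {Suc n}))
      else Pair (cd_basis n \<alpha>) (cd_zero n))"

lemma cd_zero_in_alg: "cd_zero n \<in> cd_alg n"
  by (induction n) auto

lemma cd_basis_in_alg: "cd_basis n \<alpha> \<in> cd_alg n"
  by (induction n arbitrary: \<alpha>) (auto simp: cd_zero_in_alg)

definition pure_basis :: "nat \<Rightarrow> cd set" where
  "pure_basis n = {cd_basis n \<alpha> | \<alpha>. \<alpha> \<subseteq> {1..n} \<and> \<alpha> \<noteq> {}}"

definition pure_blades :: "nat \<Rightarrow> cd set" where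
  "pure_blades n = pure_basis n \<union> uminus ` pure_basis n"

fun cd_scalar :: "nat \<Rightarrow> real \<Rightarrow> cd" where
  "cd_scalar 0 r = Scal r"
| "cd_scalar (Suc n) r = Pair (cd_scalar n r) (cd_zero n)"

definition associator :: "cd \<Rightarrow> cd \<Rightarrow> cd \<Rightarrow> cd" where
  "associator x y z = (x * y) * z - x * (y * z)"

definition type3_associative :: "nat \<Rightarrow> cd \<Rightarrow> cd \<Rightarrow> cd \<Rightarrow> bool" where
  "type3_associative n b c d \<longleftrightarrow>
     (let a = (b * c) * d in
        associator a c b = cd_zero n \<and> associator c b d = cd_zero n \<and>
        associator a d b = cd_zero n \<and> associator c a d = cd_zero n)"

definition up_to_sign :: "cd \<Rightarrow> cd set" where
  "up_to_sign x = {x, - x}"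

definition form_associative_algebra :: "cd \<Rightarrow> cd \<Rightarrow> cd \<Rightarrow> bool" where
  "form_associative_algebra x y z \<longleftrightarrow>
     x \<in> up_to_sign (y * z) \<or> y \<in> up_to_sign (x * z) \<or> z \<in> up_to_sign (x * y)"

definition no_associative_algebra :: "cd \<Rightarrow> cd \<Rightarrow> cd \<Rightarrow> cd \<Rightarrow> bool" where
  "no_associative_algebra a b c d \<longleftrightarrow>
     \<not> form_associative_algebra a b c \<and> \<not> form_associative_algebra a b d \<and>
     \<not> form_associative_algebra a c d \<and> \<not> form_associative_algebra b c d"

text \<open>
  Distinct blades may still be opposite, as in \<open>b = - a\<close>; then \<open>a + b\<close> is zero and
  hence not a zero divisor, so both factors are required to be nonzero.
\<close>

definition zero_divisor_candidate :: "nat \<Rightarrow> cd \<Rightarrow> cd \<Rightarrow> cd \<Rightarrow> cd \<Rightarrow> bool" where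
  "zero_divisor_candidate n a b c d \<longleftrightarrow>
     {a, b, c, d} \<subseteq> pure_blades n \<and> distinct [a, b, c, d] \<and>
     a + b \<noteq> cd_zero n \<and> c + d \<noteq> cd_zero n \<and> a * a = b * b \<and> c * c = d * d"

definition zero_divisor_pair :: "nat \<Rightarrow> cd \<Rightarrow> cd \<Rightarrow> cd \<Rightarrow> cd \<Rightarrow> bool" where
  "zero_divisor_pair n a b c d \<longleftrightarrow>
     zero_divisor_candidate n a b c d \<and> (a + b) * (c + d) = cd_zero n"

text \<open>
  The count runs over equations with \<open>b\<close>, \<open>c\<close>, \<open>d\<close> positive, so that only \<open>a\<close> carries a sign.
  Unordered pairs implement the identification under reversal of the product and swapping within
  brackets. Terms are compared up to sign because a swap or reversal brings another term to the
  front, to which the sign then moves: \<open>(- e + f) (g + h)\<close> is the same pair as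
  \<open>(- f + e) (g + h)\<close> and \<open>(- g + h) (e + f)\<close>.
\<close>

definition zero_divisor_class ::
    "cd \<Rightarrow> cd \<Rightarrow> cd \<Rightarrow> cd \<Rightarrow> cd set set set" where
  "zero_divisor_class a b c d =
     {{up_to_sign a, up_to_sign b}, {up_to_sign c, up_to_sign d}}"

definition zero_divisor_count :: "nat \<Rightarrow> nat" where
  "zero_divisor_count n =
     card {zero_divisor_class a b c d | a b c d.
             zero_divisor_pair n a b c d \<and> {b, c, d} \<subseteq> pure_basis n}"

text \<open>
  The ultronion algebra of index \<open>m\<close> is the Cayley--Dickson algebra of index \<open>n = m + 3\<close>.
  The index is an integer so that \<open>n > 0\<close> also covers the complex numbers and the quaternions.
\<close>

definition ultronion_Z :: "int \<Rightarrow> nat" where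
  "ultronion_Z m = zero_divisor_count (nat (m + 3))"

definition ultronion_N :: "int \<Rightarrow> nat" where
  "ultronion_N m = 2 ^ nat (m + 3) - 1"

end

theory Submission
  imports Defs
begin

text \<open>
  The product of the basis elements of \<open>A\<close> and \<open>B\<close> is, up to a sign, the basis element of the
  symmetric difference of \<open>A\<close> and \<open>B\<close>. Hence the four terms of \<open>(a + b) (c + d)\<close> can only cancel
  in the pairs \<open>ac, bd\<close> and \<open>ad, bc\<close>, and the second cancellation says \<open>a = (bc)d\<close>. All remaining
  claims concern the sign \<open>(xy)z = \<plusminus> x(yz)\<close> of a triple of basis elements: \<open>ac = - bd\<close> holds iff
  the triple \<open>c, b, d\<close> associates.

  For the count, drop the last generator \<open>n + 1\<close> from a triple of independent basis elements. If the
  result is still independent, the triple associates iff the smaller one does, except that the sign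
  flips when exactly one of the outer two factors contains \<open>n + 1\<close>; so 4 of its 8 lifts associate,
  whatever its own sign. If the result is dependent, the triple never associates. With
  \<open>N = 2\<^sup>n - 1\<close> this gives \<open>4 N (N - 1) (N - 3)\<close> associating triples in depth \<open>n + 1\<close>, and each zero
  divisor pair arises from 8 of them.
\<close>

subsection \<open>Symmetric differences\<close>

text \<open>Under this operation the index sets form a vector space over the field with two
  elements, by which the basis products are graded.\<close>

definition sdiff :: "'a set \<Rightarrow> 'a set \<Rightarrow> 'a set" (infixl "\<triangle>" 65) where
  "A \<triangle> B = (A - B) \<union> (B - A)"

lemma sdiff_commute: "A \<triangle> B = B \<triangle> A"
  and sdiff_assoc: "A \<triangle> B \<triangle> C = A \<triangle> (B \<triangle> C)"
  and sdiff_left_commute: "B \<triangle> (A \<triangle> C) = A \<triangle> (B \<triangle> C)"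
  by (auto simp: sdiff_def)

lemmas sdiff_ac = sdiff_assoc sdiff_commute sdiff_left_commute

lemma sdiff_simps [simp]:
  "A \<triangle> A = {}" "A \<triangle> {} = A" "{} \<triangle> A = A" "A \<triangle> (A \<triangle> B) = B" "B \<triangle> A \<triangle> A = B"
  by (auto simp: sdiff_def)

lemma sdiff_eq_empty_iff [simp]: "A \<triangle> B = {} \<longleftrightarrow> A = B"
  by (auto simp: sdiff_def)

lemma sdiff_cancel [simp]: "A \<triangle> B = A \<triangle> C \<longleftrightarrow> B = C" "B \<triangle> A = C \<triangle> A \<longleftrightarrow> B = C"
  "A \<triangle> B = A \<longleftrightarrow> B = {}" "A \<triangle> B = B \<longleftrightarrow> A = {}" "A = A \<triangle> B \<longleftrightarrow> B = {}" "B = A \<triangle> B \<longleftrightarrow> A = {}"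
  by (metis sdiff_simps)+

lemma sdiff_subset [simp]: "A \<subseteq> S \<Longrightarrow> B \<subseteq> S \<Longrightarrow> A \<triangle> B \<subseteq> S"
  by (auto simp: sdiff_def)

subsection \<open>Multiplication signs\<close>

text \<open>The eigenvalue of conjugation on the basis element of \<open>A\<close>; it is also the
  sign of the square of that element.\<close>

definition conj_sign :: "nat set \<Rightarrow> real" where
  "conj_sign A = (if A = {} then 1 else - 1)"

lemma conj_sign_simps [simp]: "conj_sign {} = 1" "A \<noteq> {} \<Longrightarrow> conj_sign A = - 1"
  "conj_sign A * conj_sign A = 1" "conj_sign A * (conj_sign A * x) = x"
  by (auto simp: conj_sign_def)

text \<open>The structure constants of the basis. The branches are the four products of half-zero
  pairs in the doubling formula: the left half of the product is either -w^* y or xz, the right half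
  either y z^* or wx.\<close>

fun mul_sign :: "nat \<Rightarrow> nat set \<Rightarrow> nat set \<Rightarrow> real" where
  "mul_sign 0 A B = 1"
| "mul_sign (Suc n) A B =
     (let A' = A - {Suc n}; B' = B - {Suc n} in
      if Suc n \<in> A
      then if Suc n \<in> B then - conj_sign B' * mul_sign n B' A' else conj_sign B' * mul_sign n A' B'
      else if Suc n \<in> B then mul_sign n B' A' else mul_sign n A' B')"

text \<open>The bit \<open>p\<close> records the presence of the last generator, and every subset of
  \<open>{1..Suc n}\<close> is the lift of a unique subset of \<open>{1..n}\<close> by a unique bit.
  Membership questions thus become Boolean case splits.\<close>

definition lift :: "nat \<Rightarrow> bool \<Rightarrow> nat set \<Rightarrow> nat set" where
  "lift n p A = (if p then insert (Suc n) A else A)"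

lemma lift_sdiff:
  "A \<subseteq> {1..n} \<Longrightarrow> B \<subseteq> {1..n} \<Longrightarrow> lift n p A \<triangle> lift n q B = lift n (p \<noteq> q) (A \<triangle> B)"
  by (auto simp: lift_def sdiff_def)

lemma lift_eq_iff:
  "A \<subseteq> {1..n} \<Longrightarrow> B \<subseteq> {1..n} \<Longrightarrow> lift n p A = lift n q B \<longleftrightarrow> p = q \<and> A = B"
proof -
  assume "A \<subseteq> {1..n}" "B \<subseteq> {1..n}"
  then have "Suc n \<notin> A" "Suc n \<notin> B" by auto
  then show ?thesis by (auto simp: lift_def insert_ident)
qed

lemma lift_eq_empty_iff: "lift n p A = {} \<longleftrightarrow> \<not> p \<and> A = {}"
  by (auto simp: lift_def)

lemma lift_subset: "A \<subseteq> {1..n} \<Longrightarrow> lift n p A \<subseteq> {1..Suc n}"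
  by (auto simp: lift_def)

lemma liftE:
  assumes "A \<subseteq> {1..Suc n}"
  obtains p A' where "A = lift n p A'" "A' \<subseteq> {1..n}"
proof
  show "A = lift n (Suc n \<in> A) (A - {Suc n})" by (auto simp: lift_def)
  show "A - {Suc n} \<subseteq> {1..n}" using assms le_Suc_eq by auto
qed

lemma mul_sign_lift:
  assumes "A \<subseteq> {1..n}" "B \<subseteq> {1..n}"
  shows "mul_sign (Suc n) (lift n p A) (lift n q B) =
    (if p then if q then - conj_sign B * mul_sign n B A else conj_sign B * mul_sign n A B
     else if q then mul_sign n B A else mul_sign n A B)"
proof -
  have "Suc n \<notin> A" "Suc n \<notin> B" using assms by auto
  then show ?thesis by (simp add: lift_def Let_def)
qed

declare mul_sign.simps(2) [simp del]

lemma mul_sign_cases: "mul_sign n A B = 1 \<or> mul_sign n A B = - 1"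
  by (induction n arbitrary: A B) (auto simp: mul_sign.simps(2) Let_def conj_sign_def)

lemma mul_sign_square [simp]: "mul_sign n A B * mul_sign n A B = 1"
  "mul_sign n A B * (mul_sign n A B * x) = x"
  using mul_sign_cases[of n A B] by auto

lemma mul_sign_nonzero [simp]: "mul_sign n A B \<noteq> 0"
  using mul_sign_cases[of n A B] by auto

lemma mul_sign_empty [simp]: "mul_sign n {} B = 1" "mul_sign n A {} = 1"
  by (induction n arbitrary: A B) (auto simp: mul_sign.simps(2) Let_def)

text \<open>On basis elements this is the law that conjugation reverses products. The form with
  three signs also covers the commuting cases, where a set is empty or both sets agree.\<close>

lemma mul_sign_commute:
  "A \<subseteq> {1..n} \<Longrightarrow> B \<subseteq> {1..n} \<Longrightarrow>
     mul_sign n B A = conj_sign A * conj_sign B * conj_sign (A \<triangle> B) * mul_sign n A B"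
proof (induction n arbitrary: A B)
  case 0
  then show ?case by (simp add: conj_sign_def)
next
  case (Suc n)
  obtain p A' q B' where A: "A = lift n p A'" "A' \<subseteq> {1..n}" and B: "B = lift n q B'" "B' \<subseteq> {1..n}"
    using Suc.prems by (metis liftE)
  show ?case
    using Suc.IH[OF A(2) B(2)] A B
    by (cases p; cases q)
      (auto simp: mul_sign_lift lift_sdiff lift_eq_empty_iff conj_sign_def split: if_splits)
qed

text \<open>Basis elements satisfy the left law x(xy) = (xx)y and the right law (xy)y = x(yy) at
  every depth. Doubling reverses some products, so the left law at one depth needs the right law
  below it; hence the joint induction.\<close>

lemma mul_sign_alternative:
  "A \<subseteq> {1..n} \<Longrightarrow> B \<subseteq> {1..n} \<Longrightarrow>
     mul_sign n A (A \<triangle> B) = conj_sign A * mul_sign n A B \<and>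
     mul_sign n (A \<triangle> B) B = conj_sign B * mul_sign n A B"
proof (induction n arbitrary: A B)
  case 0
  then show ?case by (simp add: conj_sign_def)
next
  case (Suc n)
  obtain p A' q B' where A: "A = lift n p A'" "A' \<subseteq> {1..n}" and B: "B = lift n q B'" "B' \<subseteq> {1..n}"
    using Suc.prems by (metis liftE)
  \<comment> \<open>These commutations undo the reversals and the conjugations that doubling
    introduces.\<close>
  note com = mul_sign_commute[OF A(2) B(2)]
    mul_sign_commute[OF A(2) sdiff_subset[OF A(2) B(2)]]
    mul_sign_commute[OF B(2) sdiff_subset[OF A(2) B(2)]]
  show ?case
    using Suc.IH[OF A(2) B(2)] Suc.IH[OF B(2) A(2)] com A B
    by (cases p; cases q)
      (auto simp: mul_sign_lift lift_sdiff lift_eq_empty_iff conj_sign_def sdiff_ac split: if_splits)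
qed

lemma mul_sign_self: "A \<subseteq> {1..n} \<Longrightarrow> mul_sign n A A = conj_sign A"
  using mul_sign_alternative[of A n "{}"] by simp

subsection \<open>Associativity signs\<close>

text \<open>The factor by which (xy)z and x(yz) differ on basis elements. A product replaces the
  quotient because each sign is its own inverse.\<close>

definition assoc_sign :: "nat \<Rightarrow> nat set \<Rightarrow> nat set \<Rightarrow> nat set \<Rightarrow> real" where
  "assoc_sign n A B C =
     mul_sign n A B * mul_sign n (A \<triangle> B) C * mul_sign n B C * mul_sign n A (B \<triangle> C)"

text \<open>Ordered triples that are linearly independent over the field with two elements. The last
  condition excludes triples that span a quaternion algebra.\<close>

definition indep :: "nat \<Rightarrow> (nat set \<times> nat set \<times> nat set) set" where
  "indep n = {(A, B, C). A \<subseteq> {1..n} \<and> B \<subseteq> {1..n} \<and> C \<subseteq> {1..n} \<and>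
     A \<noteq> {} \<and> B \<noteq> {} \<and> C \<noteq> {} \<and> A \<noteq> B \<and> A \<noteq> C \<and> B \<noteq> C \<and> A \<noteq> B \<triangle> C}"

lemma assoc_sign_cases: "assoc_sign n A B C = 1 \<or> assoc_sign n A B C = - 1"
  using mul_sign_cases[of n A B] mul_sign_cases[of n "A \<triangle> B" C] mul_sign_cases[of n B C]
    mul_sign_cases[of n A "B \<triangle> C"] by (auto simp: assoc_sign_def)

text \<open>All three conjugation signs in the commutation formula are -1.\<close>

lemma mul_sign_anticommute:
  assumes "A \<subseteq> {1..n}" "B \<subseteq> {1..n}" "A \<noteq> {}" "B \<noteq> {}" "A \<noteq> B"
  shows "mul_sign n B A = - mul_sign n A B"
  using mul_sign_commute[OF assms(1,2)] assms by simp

text \<open>Each of the four factors has its arguments swapped, and four sign changes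
  cancel.\<close>

lemma assoc_sign_reverse:
  assumes "(A, B, C) \<in> indep n"
  shows "assoc_sign n C B A = assoc_sign n A B C"
proof -
  have *: "A \<subseteq> {1..n}" "B \<subseteq> {1..n}" "C \<subseteq> {1..n}" "A \<triangle> B \<subseteq> {1..n}" "B \<triangle> C \<subseteq> {1..n}"
    "A \<noteq> {}" "B \<noteq> {}" "C \<noteq> {}" "A \<noteq> B" "A \<noteq> C" "B \<noteq> C" "A \<noteq> B \<triangle> C" "A \<triangle> B \<noteq> C"
    using assms by (auto simp: indep_def sdiff_ac)
  then show ?thesis
    by (simp add: assoc_sign_def mul_sign_anticommute[of B n C] mul_sign_anticommute[of A n B]
        mul_sign_anticommute[of "A \<triangle> B" n C] mul_sign_anticommute[of A n "B \<triangle> C"]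
        sdiff_commute[of C B] sdiff_commute[of B A])
qed

text \<open>By the alternative laws each factor is minus one of the original factors, and the four
  signs cancel.\<close>

lemma assoc_sign_middle:
  assumes "(A, B, C) \<in> indep n"
  shows "assoc_sign n A (A \<triangle> B \<triangle> C) C = assoc_sign n A B C"
proof -
  have *: "A \<subseteq> {1..n}" "B \<subseteq> {1..n}" "C \<subseteq> {1..n}" "A \<noteq> {}" "C \<noteq> {}"
    using assms by (auto simp: indep_def)
  have "mul_sign n A (A \<triangle> B) = - mul_sign n A B" "mul_sign n A (A \<triangle> (B \<triangle> C)) = - mul_sign n A (B \<triangle> C)"
    "mul_sign n (B \<triangle> C) C = - mul_sign n B C" "mul_sign n (A \<triangle> B \<triangle> C) C = - mul_sign n (A \<triangle> B) C"
    using mul_sign_alternative[of A n B] mul_sign_alternative[of A n "B \<triangle> C"]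
      mul_sign_alternative[of B n C] mul_sign_alternative[of "A \<triangle> B" n C] * by simp_all
  then show ?thesis
    by (simp add: assoc_sign_def sdiff_assoc)
qed

text \<open>Three factors change sign by the right alternative law and one by anticommutation.
  Together with the two preceding symmetries this move generates a dihedral group of order
  eight.\<close>

lemma assoc_sign_rotate:
  assumes "(A, B, C) \<in> indep n"
  shows "assoc_sign n (A \<triangle> B \<triangle> C) C B = assoc_sign n A B C"
proof -
  have *: "A \<subseteq> {1..n}" "B \<subseteq> {1..n}" "C \<subseteq> {1..n}" "B \<triangle> C \<noteq> {}" "A \<noteq> {}" "B \<noteq> {}" "C \<noteq> {}" "B \<noteq> C"
    using assms by (auto simp: indep_def)
  have "mul_sign n (A \<triangle> B \<triangle> C) C = - mul_sign n (A \<triangle> B) C" "mul_sign n (A \<triangle> B) B = - mul_sign n A B"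
    "mul_sign n C B = - mul_sign n B C" "mul_sign n (A \<triangle> (B \<triangle> C)) (B \<triangle> C) = - mul_sign n A (B \<triangle> C)"
    using mul_sign_alternative[of "A \<triangle> B" n C] mul_sign_alternative[of A n B]
      mul_sign_alternative[of A n "B \<triangle> C"] mul_sign_anticommute[of B n C] * by simp_all
  then show ?thesis
    by (simp add: assoc_sign_def sdiff_commute[of C B] sdiff_assoc[symmetric])
qed

text \<open>If the unlifted sets are independent, every conjugation sign that occurs is -1 and the
  factors of each product anticommute. Lifting then changes the sign of a product exactly when at
  least one factor contains \<open>Suc n\<close>, and over the four factors of
  \<open>assoc_sign\<close> these changes multiply to -1 exactly when \<open>p\<close> and
  \<open>r\<close> differ.\<close>

lemma assoc_sign_lift:
  assumes "A \<subseteq> {1..n}" "B \<subseteq> {1..n}" "C \<subseteq> {1..n}"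
    and "(lift n p A, lift n q B, lift n r C) \<in> indep (Suc n)"
  shows "assoc_sign (Suc n) (lift n p A) (lift n q B) (lift n r C) =
    (if (A, B, C) \<in> indep n then if p = r then assoc_sign n A B C else - assoc_sign n A B C else - 1)"
proof (cases "(A, B, C) \<in> indep n")
  case True
  then have *: "A \<noteq> {}" "B \<noteq> {}" "C \<noteq> {}" "A \<noteq> B" "A \<noteq> C" "B \<noteq> C" "A \<noteq> B \<triangle> C" "A \<triangle> B \<noteq> C"
    "A \<triangle> B \<noteq> {}" "B \<triangle> C \<noteq> {}"
    by (auto simp: indep_def sdiff_ac)
  note com = mul_sign_anticommute[of B n C] mul_sign_anticommute[of A n B]
        mul_sign_anticommute[of "A \<triangle> B" n C] mul_sign_anticommute[of A n "B \<triangle> C"]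
  show ?thesis using True assms(1-3) *
    by (cases p; cases q; cases r)
     (simp_all add: assoc_sign_def mul_sign_lift lift_sdiff com)
next
  case False
  \<comment> \<open>The lifts are independent, so the bits must break every dependency among
    \<open>A\<close>, \<open>B\<close> and \<open>C\<close>.\<close>
  have "A \<noteq> {} \<or> p" "B \<noteq> {} \<or> q" "C \<noteq> {} \<or> r" "A = B \<longrightarrow> p \<noteq> q" "A = C \<longrightarrow> p \<noteq> r"
    "B = C \<longrightarrow> q \<noteq> r" "A = B \<triangle> C \<longrightarrow> p \<noteq> (q \<noteq> r)"
    using assms by (auto simp: indep_def lift_sdiff lift_eq_iff lift_eq_empty_iff)
  moreover have "A = {} \<or> B = {} \<or> C = {} \<or> A = B \<or> A = C \<or> B = C \<or> A = B \<triangle> C"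
    using False assms(1-3) by (auto simp: indep_def)
  moreover have "mul_sign n X X = conj_sign X" if "X \<subseteq> {1..n}" for X
    using mul_sign_alternative[OF that, of "{}"] by simp
  moreover note mul_sign_alternative[OF assms(1,2)] mul_sign_alternative[OF assms(2,3)]
    mul_sign_alternative[OF assms(1,3)] mul_sign_alternative[OF assms(2,1)] mul_sign_alternative[OF assms(3,2)]
    mul_sign_commute[OF assms(1,2)] mul_sign_commute[OF assms(2,3)] mul_sign_commute[OF assms(1,3)]
  \<comment> \<open>Six eliminations split the dependency into its seven possible forms;
    alternativity and commutation settle the signs for each bit pattern.\<close>
  ultimately show ?thesis using False assms(1-3)
    by (elim disjE[of "A = {}"] disjE[of "B = {}"] disjE[of "C = {}"] disjE[of "A = B"] disjE[of "A = C"] disjE[of "B = C"];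
       cases p; cases q; cases r)
     (auto simp: assoc_sign_def mul_sign_lift lift_sdiff conj_sign_def sdiff_commute split: if_splits)
qed

subsection \<open>Counting associating triples\<close>

definition assoc_triples :: "nat \<Rightarrow> (nat set \<times> nat set \<times> nat set) set" where
  "assoc_triples n = {(A, B, C) \<in> indep n. assoc_sign n A B C = 1}"

lemma finite_indep [simp]: "finite (indep n)"
  by (rule finite_subset[of _ "Pow {1..n} \<times> Pow {1..n} \<times> Pow {1..n}"]) (auto simp: indep_def)

lemma finite_assoc_triples [simp]: "finite (assoc_triples n)"
  by (rule finite_subset[OF _ finite_indep[of n]]) (auto simp: assoc_triples_def)

text \<open>\<open>A\<close> is any nonzero vector, \<open>B\<close> any other one, and
  \<open>C\<close> avoids the three nonzero vectors of their span.\<close>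

lemma card_indep:
  "real (card (indep n)) = (2 ^ n - 1) * (2 ^ n - 2) * (2 ^ n - 4)"
proof -
  define P where "P = Pow {1..n} - {{}}"
  have P: "finite P" "card P = 2 ^ n - 1" by (simp_all add: P_def card_Pow)
  have P_minus: "card (P - {A}) = 2 ^ n - 2" if "A \<in> P" for A
    using that P by (simp add: numeral_2_eq_2)
  have P_sdiff: "A \<triangle> B \<in> P" if "A \<in> P" "B \<in> P" "A \<noteq> B" for A B
    using that by (simp add: P_def)
  have "indep n = (SIGMA A:P. SIGMA B:P - {A}. P - {A, B, A \<triangle> B})"
    by (auto simp: indep_def P_def sdiff_ac)
  moreover have "card (P - {A, B, A \<triangle> B}) = 2 ^ n - 4" if "A \<in> P" "B \<in> P - {A}" for A B
  proof -
    have "A \<noteq> {}" "B \<noteq> {}" "A \<noteq> B" using that by (auto simp: P_def)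
    then have "card {A, B, A \<triangle> B} = 3" by simp
    then show ?thesis using that P P_sdiff by (subst card_Diff_subset) auto
  qed
  ultimately have "card (indep n) = (2 ^ n - 1) * ((2 ^ n - 2) * (2 ^ n - 4))"
    using P P_minus by (simp del: card_Diff_insert)
  moreover have "real (2 ^ n - 1) * (real (2 ^ n - 2) * real (2 ^ n - 4)) = (2 ^ n - 1) * (2 ^ n - 2) * (2 ^ n - 4)"
  proof -
    \<comment> \<open>Natural subtraction truncates for \<open>n\<close> below 2, but there a factor
      vanishes on both sides.\<close>
    consider "n = 0" | "n = 1" | k where "n = Suc (Suc k)" by (metis One_nat_def not0_implies_Suc)
    then show ?thesis
    proof cases
      case (3 k)
      have "(1::nat) \<le> 2 ^ n" "(2::nat) \<le> 2 ^ n" "(4::nat) \<le> 2 ^ n" by (simp_all add: 3)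
      then show ?thesis by (simp add: of_nat_diff)
    qed simp_all
  qed
  ultimately show ?thesis by (simp only: of_nat_mult)
qed

text \<open>An independent triple whose projection is dependent never associates, so each
  associating triple comes from a unique independent triple and bit pattern. The bits
  \<open>p\<close> and \<open>q\<close> are free and determine \<open>r\<close>, which leaves four
  patterns.\<close>

lemma card_assoc_triples_Suc: "card (assoc_triples (Suc n)) = 4 * card (indep n)"
proof -
  define lifts where "lifts = (\<lambda>(A, B, C). {(p :: bool, q :: bool, r). (p = r) = (assoc_sign n A B C = 1)})"
  define F where "F = (\<lambda>((A, B, C), (p, q, r)). (lift n p A, lift n q B, lift n r C))"
  have lifts: "card (lifts t) = 4" for t
  proof -
    obtain A B C where t: "t = (A, B, C)" by (cases t)
    have "lifts t = (if assoc_sign n A B C = 1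
        then {(True, True, True), (True, False, True), (False, True, False), (False, False, False)}
        else {(True, True, False), (True, False, False), (False, True, True), (False, False, True)})"
      by (auto simp: lifts_def t)
    then show ?thesis by simp
  qed
  have "inj_on F (Sigma (indep n) lifts)"
  proof (rule inj_onI)
    fix x y assume "x \<in> Sigma (indep n) lifts" "y \<in> Sigma (indep n) lifts" and eq: "F x = F y"
    then obtain A B C p q r A' B' C' p' q' r' where
      xy: "x = ((A, B, C), (p, q, r))" "y = ((A', B', C'), (p', q', r'))"
      and "(A, B, C) \<in> indep n" "(A', B', C') \<in> indep n"
      by (cases x; cases y) auto
    then have "A \<subseteq> {1..n}" "B \<subseteq> {1..n}" "C \<subseteq> {1..n}" "A' \<subseteq> {1..n}" "B' \<subseteq> {1..n}" "C' \<subseteq> {1..n}"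
      by (auto simp: indep_def)
    then show "x = y" using eq by (simp add: xy F_def lift_eq_iff)
  qed
  moreover have "F ` Sigma (indep n) lifts = assoc_triples (Suc n)"
  proof (intro equalityI subsetI)
    fix t assume "t \<in> F ` Sigma (indep n) lifts"
    then obtain x where x: "x \<in> Sigma (indep n) lifts" "t = F x" by blast
    obtain A B C p q r where "x = ((A, B, C), (p, q, r))" by (cases x) auto
    with x have t: "t = (lift n p A, lift n q B, lift n r C)"
      "(A, B, C) \<in> indep n" "(p = r) = (assoc_sign n A B C = 1)"
      by (simp_all add: F_def lifts_def)
    then have sub: "A \<subseteq> {1..n}" "B \<subseteq> {1..n}" "C \<subseteq> {1..n}" by (auto simp: indep_def)
    then have "t \<in> indep (Suc n)"
      using t(2) sub
      by (simp add: t(1) indep_def lift_sdiff lift_eq_iff lift_eq_empty_iff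
          lift_subset[unfolded One_nat_def])
    then show "t \<in> assoc_triples (Suc n)"
      using t assoc_sign_lift[OF sub] assoc_sign_cases[of n A B C] by (auto simp: assoc_triples_def)
  next
    fix t assume t: "t \<in> assoc_triples (Suc n)"
    then obtain X Y Z where "t = (X, Y, Z)" "X \<subseteq> {1..Suc n}" "Y \<subseteq> {1..Suc n}" "Z \<subseteq> {1..Suc n}"
      by (auto simp: assoc_triples_def indep_def)
    then obtain A B C p q r where t': "t = (lift n p A, lift n q B, lift n r C)" and
      sub: "A \<subseteq> {1..n}" "B \<subseteq> {1..n}" "C \<subseteq> {1..n}"
      by (metis liftE)
    have "(A, B, C) \<in> indep n" "(p = r) = (assoc_sign n A B C = 1)"
      using t assoc_sign_lift[OF sub, of p q r] assoc_sign_cases[of n A B C]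
      by (auto simp: t' assoc_triples_def split: if_splits)
    then have "((A, B, C), (p, q, r)) \<in> Sigma (indep n) lifts" by (auto simp: lifts_def)
    then show "t \<in> F ` Sigma (indep n) lifts" by (force simp: t' F_def)
  qed
  ultimately have "card (assoc_triples (Suc n)) = card (Sigma (indep n) lifts)"
    by (metis card_image)
  moreover have "finite (lifts t)" for t using lifts[of t] card.infinite by fastforce
  ultimately show ?thesis using lifts by simp
qed

section \<open>Eight associating triples for each pairing of four index sets\<close>

lemma card_image_const_fibres:
  assumes "finite T" and "\<And>t. t \<in> T \<Longrightarrow> card {s \<in> T. f s = f t} = k"
  shows "card T = k * card (f ` T)"
proof -
  have "card T = (\<Sum>y\<in>f ` T. card {s \<in> T. f s = y})"
    using sum.image_gen[OF assms(1), of "\<lambda>_. 1::nat" f] by simp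
  also have "\<dots> = (\<Sum>y\<in>f ` T. k)"
    using assms(2) by (intro sum.cong) auto
  finally show ?thesis by simp
qed

text \<open>The triple stands for (a + b)(c + d) with \<open>A\<close>, \<open>B\<close>,
  \<open>C\<close> the indices of c, b, d, and with the index of a as their sum. The map
  \<open>U\<close> chooses how an index set is represented, so that the count can be made before
  blades appear.\<close>

definition pairing :: "('a set \<Rightarrow> 'b) \<Rightarrow> 'a set \<times> 'a set \<times> 'a set \<Rightarrow> 'b set set" where
  "pairing U = (\<lambda>(A, B, C). {{U (A \<triangle> B \<triangle> C), U B}, {U A, U C}})"

text \<open>Each move is an invertible linear change of the three vectors.\<close>

lemma indep_symmetries:
  assumes "(A, B, C) \<in> indep n"
  shows "(C, B, A) \<in> indep n" "(A, A \<triangle> B \<triangle> C, C) \<in> indep n" "(A \<triangle> B \<triangle> C, C, B) \<in> indep n"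
proof -
  have *: "A \<subseteq> {1..n}" "B \<subseteq> {1..n}" "C \<subseteq> {1..n}"
    "A \<noteq> {}" "B \<noteq> {}" "C \<noteq> {}" "A \<noteq> B" "A \<noteq> C" "B \<noteq> C" "A \<noteq> B \<triangle> C"
    using assms by (simp_all add: indep_def)
  \<comment> \<open>Each form brings a different set to the front, where the cancellation rules
    apply.\<close>
  have eqs: "A \<triangle> B \<triangle> C = A \<triangle> (B \<triangle> C)" "A \<triangle> B \<triangle> C = B \<triangle> (A \<triangle> C)" "A \<triangle> B \<triangle> C = C \<triangle> (A \<triangle> B)"
    by (simp_all only: sdiff_ac)
  have "A \<triangle> B \<triangle> C \<noteq> {}" "A \<triangle> B \<triangle> C \<noteq> A" unfolding eqs(1) using * by simp_all
  moreover have "A \<triangle> B \<triangle> C \<noteq> B" unfolding eqs(2) using * by simp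
  moreover have "A \<triangle> B \<triangle> C \<noteq> C" "A \<triangle> B \<noteq> C" using * by (metis sdiff_simps(1,2,5) sdiff_assoc)+
  moreover have "C \<triangle> B \<noteq> A" "B \<triangle> A \<noteq> C" "A \<triangle> B \<triangle> C \<noteq> C \<triangle> B"
    using * calculation by (simp_all add: sdiff_commute[of C B] sdiff_commute[of B A] sdiff_assoc)
  moreover have "A \<triangle> B \<triangle> C \<triangle> C \<noteq> A" using * by simp
  ultimately show "(C, B, A) \<in> indep n" "(A, A \<triangle> B \<triangle> C, C) \<in> indep n" "(A \<triangle> B \<triangle> C, C, B) \<in> indep n"
    using * by (simp_all add: indep_def)
qed

lemma assoc_triples_symmetries:
  assumes "(A, B, C) \<in> assoc_triples n"
  shows "(C, B, A) \<in> assoc_triples n" "(A, A \<triangle> B \<triangle> C, C) \<in> assoc_triples n"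
    "(A \<triangle> B \<triangle> C, C, B) \<in> assoc_triples n"
  using assms indep_symmetries[of A B C n]
  by (simp_all add: assoc_triples_def assoc_sign_reverse assoc_sign_middle assoc_sign_rotate)

text \<open>A fibre is one orbit of the dihedral symmetries: choose which pair is outer, the order
  within it, and which element of the other pair is in the middle. The remaining element is then the
  sum of these three.\<close>

lemma card_assoc_triples_pairing:
  assumes inj: "inj_on U (Pow {1..n})"
  shows "card (assoc_triples n) = 8 * card (pairing U ` assoc_triples n)"
proof (rule card_image_const_fibres)
  fix t assume "t \<in> assoc_triples n"
  then obtain A B C where t: "t = (A, B, C)" and ABC: "(A, B, C) \<in> assoc_triples n" by (cases t) auto
  define D where "D = A \<triangle> B \<triangle> C"
  have ind: "(A, B, C) \<in> indep n"
    using ABC by (auto simp: assoc_triples_def)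
  have D: "D = A \<triangle> (B \<triangle> C)" "D = B \<triangle> (A \<triangle> C)" "D = C \<triangle> (A \<triangle> B)"
    by (simp_all only: D_def sdiff_ac)
  have sub: "A \<subseteq> {1..n}" "B \<subseteq> {1..n}" "C \<subseteq> {1..n}" and dist: "A \<noteq> B" "A \<noteq> C" "B \<noteq> C"
    using ind by (simp_all add: indep_def)
  then have "D \<subseteq> {1..n}" "A \<noteq> D" by (simp_all add: D(1))
  moreover have "B \<noteq> D" using dist by (simp add: D(2))
  moreover have "C \<noteq> D" using dist by (simp add: D(3))
  moreover note sub dist
  ultimately have sub: "A \<subseteq> {1..n}" "B \<subseteq> {1..n}" "C \<subseteq> {1..n}" "D \<subseteq> {1..n}"
    and dist: "A \<noteq> B" "A \<noteq> C" "A \<noteq> D" "B \<noteq> C" "B \<noteq> D" "C \<noteq> D"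
    by blast+
  have D_eqs: "A \<triangle> D \<triangle> C = B" "C \<triangle> D \<triangle> A = B" "C \<triangle> B \<triangle> A = D" "D \<triangle> C \<triangle> B = A"
     "B \<triangle> C \<triangle> D = A" "D \<triangle> A \<triangle> B = C" "B \<triangle> A \<triangle> D = C" "A \<triangle> B \<triangle> C = D"
    by (simp_all add: D_def sdiff_ac)
  let ?F = "{(A, B, C), (C, B, A), (A, D, C), (C, D, A), (D, C, B), (B, C, D), (D, A, B), (B, A, D)}"
  have mem: "?F \<subseteq> assoc_triples n"
    using assoc_triples_symmetries ABC D_eqs by (simp, metis)
  have "{s \<in> assoc_triples n. pairing U s = pairing U t} = ?F"
  proof (intro equalityI subsetI)
    fix s assume "s \<in> {s \<in> assoc_triples n. pairing U s = pairing U t}"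
    then obtain X Y Z where s: "s = (X, Y, Z)" "X \<subseteq> {1..n}" "Y \<subseteq> {1..n}" "Z \<subseteq> {1..n}"
      and eq: "pairing U (X, Y, Z) = pairing U (A, B, C)"
      by (cases s) (auto simp: assoc_triples_def indep_def t)
    define E where "E = X \<triangle> Y \<triangle> Z"
    have E: "E \<subseteq> {1..n}" unfolding E_def using s by (intro sdiff_subset)
    have U: "U P = U Q \<longleftrightarrow> P = Q" if "P \<subseteq> {1..n}" "Q \<subseteq> {1..n}" for P Q
      using inj that by (simp add: inj_on_eq_iff)
    have "{{U E, U Y}, {U X, U Z}} = {{U D, U B}, {U A, U C}}"
      using eq by (simp only: pairing_def prod.case E_def D_def)
    then have "(Y = B \<or> Y = D) \<and> (X = A \<and> Z = C \<or> X = C \<and> Z = A) \<or>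
        (Y = A \<or> Y = C) \<and> (X = D \<and> Z = B \<or> X = B \<and> Z = D)"
      unfolding doubleton_eq_iff U[OF E sub(4)] U[OF E sub(2)] U[OF s(3) sub(4)] U[OF s(3) sub(2)]
        U[OF E sub(1)] U[OF E sub(3)] U[OF s(3) sub(1)] U[OF s(3) sub(3)]
        U[OF s(2) sub(1)] U[OF s(2) sub(3)] U[OF s(4) sub(1)] U[OF s(4) sub(3)]
        U[OF s(2) sub(4)] U[OF s(2) sub(2)] U[OF s(4) sub(4)] U[OF s(4) sub(2)]
      by (elim disjE conjE) simp_all
    then show "s \<in> ?F" unfolding s(1) by (elim disjE conjE) simp_all
  next
    fix s assume "s \<in> ?F"
    then show "s \<in> {s \<in> assoc_triples n. pairing U s = pairing U t}"
      using mem by (auto simp: pairing_def t D_eqs insert_commute)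
  qed
  moreover have "card ?F = 8" using dist by auto
  ultimately show "card {s \<in> assoc_triples n. pairing U s = pairing U t} = 8" by simp
qed simp

subsection \<open>Scaled basis elements\<close>

text \<open>The basis element of \<open>A\<close> scaled by \<open>r\<close>, with the scalar stored
  at a leaf; this follows the recursion of \<open>cd_basis\<close>.\<close>

fun blade :: "nat \<Rightarrow> real \<Rightarrow> nat set \<Rightarrow> cd" where
  "blade 0 r A = Scal r"
| "blade (Suc n) r A =
     (if Suc n \<in> A then Pair (cd_zero n) (blade n r (A - {Suc n}))
      else Pair (blade n r A) (cd_zero n))"

fun coeff :: "nat \<Rightarrow> cd \<Rightarrow> nat set \<Rightarrow> real" where
  "coeff 0 (Scal r) A = r"
| "coeff (Suc n) (Pair x y) A = (if Suc n \<in> A then coeff n y (A - {Suc n}) else coeff n x A)"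
| "coeff _ _ A = 0"

lemma cd_basis_eq_blade: "cd_basis n A = blade n 1 A"
  by (induction n arbitrary: A) auto

section \<open>Closure, additive laws and distributivity\<close>

lemma cd_neg_zero [simp]: "cd_neg (cd_zero n) = cd_zero n"
  by (induction n) auto

lemma cd_conj_zero [simp]: "cd_conj (cd_zero n) = cd_zero n"
  by (induction n) auto

lemma cd_alg_closed [simp]:
  "cd_zero n \<in> cd_alg n"
  "blade n r A \<in> cd_alg n"
  "x \<in> cd_alg n \<Longrightarrow> cd_neg x \<in> cd_alg n"
  "x \<in> cd_alg n \<Longrightarrow> cd_conj x \<in> cd_alg n"
  "x \<in> cd_alg n \<Longrightarrow> y \<in> cd_alg n \<Longrightarrow> cd_add x y \<in> cd_alg n"
proof -
  show zero: "cd_zero n \<in> cd_alg n" for n by (rule cd_zero_in_alg)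
  show "blade n r A \<in> cd_alg n" by (induction n arbitrary: A) (auto simp: zero)
  show neg: "x \<in> cd_alg n \<Longrightarrow> cd_neg x \<in> cd_alg n" for n x by (induction n arbitrary: x) auto
  show "x \<in> cd_alg n \<Longrightarrow> cd_conj x \<in> cd_alg n" by (induction n arbitrary: x) (auto simp: neg)
  show "x \<in> cd_alg n \<Longrightarrow> y \<in> cd_alg n \<Longrightarrow> cd_add x y \<in> cd_alg n"
    by (induction n arbitrary: x y) fastforce+
qed

lemma cd_mul_closed [simp]: "x \<in> cd_alg n \<Longrightarrow> y \<in> cd_alg n \<Longrightarrow> cd_mul x y \<in> cd_alg n"
  by (induction n arbitrary: x y) auto

lemma cd_add_zero [simp]:
  "x \<in> cd_alg n \<Longrightarrow> cd_add x (cd_zero n) = x" "x \<in> cd_alg n \<Longrightarrow> cd_add (cd_zero n) x = x"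
  by (induction n arbitrary: x) auto

lemma cd_mul_zero [simp]:
  "x \<in> cd_alg n \<Longrightarrow> cd_mul x (cd_zero n) = cd_zero n \<and> cd_mul (cd_zero n) x = cd_zero n"
  by (induction n arbitrary: x) auto

lemma cd_add_commute: "cd_add x y = cd_add y x"
  by (induction x y rule: cd_add.induct) auto

lemma cd_add_assoc:
  "x \<in> cd_alg n \<Longrightarrow> y \<in> cd_alg n \<Longrightarrow> z \<in> cd_alg n \<Longrightarrow>
     cd_add (cd_add x y) z = cd_add x (cd_add y z)"
  by (induction n arbitrary: x y z) auto

lemma cd_add_interchange:
  assumes "x \<in> cd_alg n" "y \<in> cd_alg n" "z \<in> cd_alg n" "w \<in> cd_alg n"
  shows "cd_add (cd_add x y) (cd_add z w) = cd_add (cd_add x z) (cd_add y w)"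
proof -
  have "cd_add y (cd_add z w) = cd_add z (cd_add y w)"
    using assms by (simp add: cd_add_assoc[of _ n, symmetric] cd_add_commute[of y z])
  then show ?thesis using assms by (simp add: cd_add_assoc[of _ n])
qed

lemma cd_neg_add:
  "x \<in> cd_alg n \<Longrightarrow> y \<in> cd_alg n \<Longrightarrow> cd_neg (cd_add x y) = cd_add (cd_neg x) (cd_neg y)"
  by (induction n arbitrary: x y) auto

lemma cd_conj_add:
  "x \<in> cd_alg n \<Longrightarrow> y \<in> cd_alg n \<Longrightarrow> cd_conj (cd_add x y) = cd_add (cd_conj x) (cd_conj y)"
  by (induction n arbitrary: x y) (auto simp: cd_neg_add)

text \<open>Negation and conjugation are additive, so each half of the doubled product is additive
  in either argument up to regrouping of four summands.\<close>

lemma cd_mul_add: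
  "x \<in> cd_alg n \<Longrightarrow> y \<in> cd_alg n \<Longrightarrow> z \<in> cd_alg n \<Longrightarrow>
     cd_mul (cd_add x y) z = cd_add (cd_mul x z) (cd_mul y z) \<and>
     cd_mul z (cd_add x y) = cd_add (cd_mul z x) (cd_mul z y)"
proof (induction n arbitrary: x y z)
  case 0
  then show ?case by (auto simp: algebra_simps)
next
  case (Suc n)
  then show ?case
    by (auto simp: cd_neg_add[of _ n] cd_conj_add[of _ n] cd_add_interchange[of _ n])
qed

section \<open>Coordinates in the graded basis\<close>

lemma coeff_zero [simp]: "coeff n (cd_zero n) A = 0"
  by (induction n arbitrary: A) auto

lemma coeff_add:
  "x \<in> cd_alg n \<Longrightarrow> y \<in> cd_alg n \<Longrightarrow> coeff n (cd_add x y) A = coeff n x A + coeff n y A"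
  by (induction n arbitrary: x y A) auto

lemma blade_lift:
  assumes "A \<subseteq> {1..n}"
  shows "blade (Suc n) r (lift n p A) =
    (if p then Pair (cd_zero n) (blade n r A) else Pair (blade n r A) (cd_zero n))"
proof -
  have "Suc n \<notin> A" using assms by auto
  then show ?thesis by (simp add: lift_def)
qed

lemma coeff_lift:
  assumes "A \<subseteq> {1..n}"
  shows "coeff (Suc n) (Pair x y) (lift n p A) = (if p then coeff n y A else coeff n x A)"
proof -
  have "Suc n \<notin> A" using assms by auto
  then show ?thesis by (simp add: lift_def)
qed

lemma coeff_blade:
  "A \<subseteq> {1..n} \<Longrightarrow> B \<subseteq> {1..n} \<Longrightarrow> coeff n (blade n r A) B = (if A = B then r else 0)"
proof (induction n arbitrary: A B)
  case (Suc n)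
  obtain p A' q B' where "A = lift n p A'" "A' \<subseteq> {1..n}" "B = lift n q B'" "B' \<subseteq> {1..n}"
    using Suc.prems by (metis liftE)
  then show ?case
    using Suc.IH[of A' B'] by (auto simp: blade_lift coeff_lift lift_eq_iff simp del: blade.simps coeff.simps)
qed auto

text \<open>A set without \<open>Suc n\<close> reads a coordinate of the left half and a set with it
  one of the right half, so induction applies to both halves.\<close>

lemma cd_eq_iff_coeff:
  "x \<in> cd_alg n \<Longrightarrow> y \<in> cd_alg n \<Longrightarrow> x = y \<longleftrightarrow> (\<forall>A\<subseteq>{1..n}. coeff n x A = coeff n y A)"
proof (induction n arbitrary: x y)
  case (Suc n)
  obtain x1 x2 y1 y2 where xy: "x = Pair x1 x2" "y = Pair y1 y2"
    "x1 \<in> cd_alg n" "x2 \<in> cd_alg n" "y1 \<in> cd_alg n" "y2 \<in> cd_alg n"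
    using Suc.prems by auto
  have "coeff n x1 A = coeff n y1 A \<and> coeff n x2 A = coeff n y2 A"
    if *: "\<forall>A\<subseteq>{1..Suc n}. coeff (Suc n) x A = coeff (Suc n) y A" and A: "A \<subseteq> {1..n}" for A
  proof -
    have "Suc n \<notin> A" "A \<subseteq> {1..Suc n}" "insert (Suc n) A \<subseteq> {1..Suc n}" using A by auto
    then show ?thesis using *[rule_format, of A] *[rule_format, of "insert (Suc n) A"]
      by (simp add: xy)
  qed
  then have "x1 = y1 \<and> x2 = y2"
    if "\<forall>A\<subseteq>{1..Suc n}. coeff (Suc n) x A = coeff (Suc n) y A"
    using Suc.IH[of x1 y1] Suc.IH[of x2 y2] xy(3-6) that by simp
  then show ?case unfolding xy(1,2) by blast
qed auto

section \<open>Conjugation, products and sums of scaled basis elements\<close>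

lemma cd_neg_blade [simp]: "cd_neg (blade n r A) = blade n (- r) A"
  by (induction n arbitrary: A) auto

lemma blade_zero [simp]: "blade n 0 A = cd_zero n"
  by (induction n arbitrary: A) auto

lemma cd_scalar_eq_blade: "cd_scalar n r = blade n r {}"
  by (induction n) auto

lemma cd_conj_blade: "A \<subseteq> {1..n} \<Longrightarrow> cd_conj (blade n r A) = blade n (conj_sign A * r) A"
proof (induction n arbitrary: A)
  case (Suc n)
  show ?case
  proof (cases "Suc n \<in> A")
    case True
    then have "A \<noteq> {}" by auto
    then show ?thesis using True by simp
  next
    case False
    then have "A \<subseteq> {1..n}" using Suc.prems le_Suc_eq by auto
    then show ?thesis using False Suc.IH by simp
  qed
qed simp

text \<open>Each factor has one zero half, so a single product survives in the doubling formula, and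
  its sign is the matching branch of \<open>mul_sign\<close>.\<close>

lemma cd_mul_blade:
  "A \<subseteq> {1..n} \<Longrightarrow> B \<subseteq> {1..n} \<Longrightarrow>
     cd_mul (blade n r A) (blade n s B) = blade n (r * s * mul_sign n A B) (A \<triangle> B)"
proof (induction n arbitrary: A B r s)
  case 0
  then show ?case by simp
next
  case (Suc n)
  obtain p A' q B' where A: "A = lift n p A'" "A' \<subseteq> {1..n}" and B: "B = lift n q B'" "B' \<subseteq> {1..n}"
    using Suc.prems by (metis liftE)
  note Suc.IH[OF A(2) B(2)] Suc.IH[OF B(2) A(2)]
  then show ?case using A B
    by (cases p; cases q)
      (simp_all add: blade_lift lift_sdiff mul_sign_lift cd_conj_blade sdiff_commute mult_ac del: blade.simps)
qed

lemma blade_eq_iff: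
  assumes "A \<subseteq> {1..n}" "B \<subseteq> {1..n}"
  shows "blade n r A = blade n s B \<longleftrightarrow> r = s \<and> (r = 0 \<or> A = B)"
  using assms by (auto simp: cd_eq_iff_coeff[of _ n] coeff_blade)

lemma blade_sum_eq_zero_iff:
  assumes "A \<subseteq> {1..n}" "B \<subseteq> {1..n}" "r \<noteq> 0"
  shows "cd_add (blade n r A) (blade n s B) = cd_zero n \<longleftrightarrow> A = B \<and> r = - s"
proof
  assume "cd_add (blade n r A) (blade n s B) = cd_zero n"
  then have "coeff n (cd_add (blade n r A) (blade n s B)) A = coeff n (cd_zero n) A" by simp
  then show "A = B \<and> r = - s" using assms by (auto simp: coeff_add coeff_blade split: if_splits)
next
  assume "A = B \<and> r = - s"
  then show "cd_add (blade n r A) (blade n s B) = cd_zero n"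
    using assms by (auto simp: cd_eq_iff_coeff[of _ n] coeff_add coeff_blade)
qed

subsection \<open>Zero divisors\<close>

lemma blade_mult:
  "A \<subseteq> {1..n} \<Longrightarrow> B \<subseteq> {1..n} \<Longrightarrow>
     blade n r A * blade n s B = blade n (r * s * mul_sign n A B) (A \<triangle> B)"
  by (simp add: times_cd_def cd_mul_blade)

lemma blade_uminus [simp]: "- blade n r A = blade n (- r) A"
  by (simp add: uminus_cd_def)

lemma pure_basis_iff: "x \<in> pure_basis n \<longleftrightarrow> (\<exists>A. A \<subseteq> {1..n} \<and> A \<noteq> {} \<and> x = blade n 1 A)"
  by (auto simp: pure_basis_def cd_basis_eq_blade)

lemma pure_blades_iff:
  "x \<in> pure_blades n \<longleftrightarrow> (\<exists>s A. s \<in> {1, - 1} \<and> A \<subseteq> {1..n} \<and> A \<noteq> {} \<and> x = blade n s A)"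
proof
  assume "x \<in> pure_blades n"
  then obtain y where y: "y \<in> pure_basis n" "x = y \<or> x = - y"
    by (auto simp: pure_blades_def)
  then obtain A where A: "A \<subseteq> {1..n}" "A \<noteq> {}" "y = blade n 1 A"
    by (auto simp: pure_basis_iff)
  then have "x = blade n 1 A \<or> x = blade n (- 1) A" using y by auto
  with A show "\<exists>s A. s \<in> {1, - 1} \<and> A \<subseteq> {1..n} \<and> A \<noteq> {} \<and> x = blade n s A" by blast
next
  assume "\<exists>s A. s \<in> {1, - 1} \<and> A \<subseteq> {1..n} \<and> A \<noteq> {} \<and> x = blade n s A"
  then obtain s A where "s = 1 \<or> s = - 1" "A \<subseteq> {1..n}" "A \<noteq> {}" "x = blade n s A" by auto
  moreover from this have "blade n 1 A \<in> pure_basis n" by (auto simp: pure_basis_iff)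
  ultimately show "x \<in> pure_blades n"
    by (auto simp: pure_blades_def intro: image_eqI[of _ _ "blade n 1 A"])
qed

text \<open>Since \<open>A\<close> differs from \<open>B\<close> and \<open>C\<close> from
  \<open>D\<close>, a parallel term never shares its index with a cross term. Hence the parallel
  terms can only cancel each other, and likewise the cross terms.\<close>

lemma blade_product_eq_zero_iff:
  assumes "A \<subseteq> {1..n}" "B \<subseteq> {1..n}" "C \<subseteq> {1..n}" "D \<subseteq> {1..n}"
    and "A \<noteq> B" "C \<noteq> D" and nz: "s \<noteq> 0" "t \<noteq> 0" "u \<noteq> 0" "v \<noteq> 0"
  shows "(blade n s A + blade n t B) * (blade n u C + blade n v D) = cd_zero n \<longleftrightarrow>
    blade n s A * blade n u C + blade n t B * blade n v D = cd_zero n \<and>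
    blade n s A * blade n v D + blade n t B * blade n u C = cd_zero n"
    (is "?P = cd_zero n \<longleftrightarrow> ?ac + ?bd = cd_zero n \<and> ?ad + ?bc = cd_zero n")
proof -
  have alg: "?ac \<in> cd_alg n" "?bd \<in> cd_alg n" "?ad \<in> cd_alg n" "?bc \<in> cd_alg n"
    by (simp_all add: times_cd_def)
  have P: "?P = cd_add (?ac + ?bd) (?ad + ?bc)"
    by (simp add: plus_cd_def times_cd_def cd_mul_add[of _ n] cd_add_interchange[of _ n] cd_add_commute)
  show ?thesis
  proof
    assume "?P = cd_zero n"
    then have "coeff n (cd_add (?ac + ?bd) (?ad + ?bc)) X = 0" for X
      unfolding P by simp
    then have sum: "coeff n ?ac X + coeff n ?bd X + (coeff n ?ad X + coeff n ?bc X) = 0" for X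
      using alg by (simp add: plus_cd_def coeff_add)
    have idx: "A \<triangle> C \<noteq> A \<triangle> D" "A \<triangle> C \<noteq> B \<triangle> C" "A \<triangle> D \<noteq> B \<triangle> D"
      using assms by auto
    \<comment> \<open>The nonzero coefficient of ac at its own index must be cancelled, and only bd
      can share that index; the same holds for ad and bc.\<close>
    have "B \<triangle> D = A \<triangle> C" "B \<triangle> C = A \<triangle> D"
      using sum[of "A \<triangle> C"] sum[of "A \<triangle> D"] idx nz assms(1-4)
      by (auto simp: blade_mult coeff_blade split: if_splits)
    then show "?ac + ?bd = cd_zero n \<and> ?ad + ?bc = cd_zero n"
      using sum[of "A \<triangle> C"] sum[of "A \<triangle> D"] idx nz assms(1-4)
      by (simp add: blade_mult coeff_blade plus_cd_def blade_sum_eq_zero_iff)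
  next
    assume "?ac + ?bd = cd_zero n \<and> ?ad + ?bc = cd_zero n"
    then show "?P = cd_zero n" by (simp add: P)
  qed
qed

text \<open>Multiply by d on the right: the right alternative law and d^2 = -1 turn ((bc)d)d into
  -bc. The step is reversible.\<close>

lemma blade_eq_triple_product_iff:
  assumes "A \<subseteq> {1..n}" "B \<subseteq> {1..n}" "C \<subseteq> {1..n}" "D \<subseteq> {1..n}" "D \<noteq> {}"
    and sgn: "s \<in> {1, - 1}" "t \<in> {1, - 1}" "u \<in> {1, - 1}" "v \<in> {1, - 1}"
  shows "blade n s A = (blade n t B * blade n u C) * blade n v D \<longleftrightarrow>
    blade n s A * blade n v D + blade n t B * blade n u C = cd_zero n"
proof -
  have nz: "s \<noteq> 0" "t \<noteq> 0" "u \<noteq> 0" "v \<noteq> 0" using sgn by auto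
  have idx: "A = B \<triangle> C \<triangle> D \<longleftrightarrow> A \<triangle> D = B \<triangle> C" by (metis sdiff_simps(5))
  have "mul_sign n (B \<triangle> C \<triangle> D) D = - mul_sign n (B \<triangle> C) D"
    using mul_sign_alternative[of "B \<triangle> C" n D] assms by simp
  then have sign: "mul_sign n A D = - mul_sign n (B \<triangle> C) D" if "A = B \<triangle> C \<triangle> D"
    using that by simp
  have "blade n s A = (blade n t B * blade n u C) * blade n v D \<longleftrightarrow>
      A = B \<triangle> C \<triangle> D \<and> s = t * u * mul_sign n B C * v * mul_sign n (B \<triangle> C) D"
    using assms(1-4) nz by (auto simp: blade_mult blade_eq_iff)
  also have "\<dots> \<longleftrightarrow> A = B \<triangle> C \<triangle> D \<and> s * v * mul_sign n A D = - (t * u * mul_sign n B C)"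
  proof (rule conj_cong[OF refl])
    assume "A = B \<triangle> C \<triangle> D"
    from sign[OF this] sgn(4) mul_sign_cases[of n "B \<triangle> C" D]
    show "s = t * u * mul_sign n B C * v * mul_sign n (B \<triangle> C) D \<longleftrightarrow>
        s * v * mul_sign n A D = - (t * u * mul_sign n B C)"
      by (elim disjE) auto
  qed
  also have "\<dots> \<longleftrightarrow> blade n s A * blade n v D + blade n t B * blade n u C = cd_zero n"
    using assms(1-4) nz by (simp add: blade_mult plus_cd_def blade_sum_eq_zero_iff idx)
  finally show ?thesis .
qed

text \<open>The three alternatives give the same relation between index sets, because the operation
  is an involution in each argument.\<close>

lemma form_associative_algebra_blade:
  assumes "A \<subseteq> {1..n}" "B \<subseteq> {1..n}" "C \<subseteq> {1..n}"
    and "s \<noteq> 0" "t \<noteq> 0" "u \<noteq> 0"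
    and "form_associative_algebra (blade n s A) (blade n t B) (blade n u C)"
  shows "A = B \<triangle> C"
proof -
  have "A = B \<triangle> C \<or> B = A \<triangle> C \<or> C = A \<triangle> B"
    using assms by (auto simp: form_associative_algebra_def up_to_sign_def blade_mult blade_eq_iff)
  then show ?thesis by (auto simp: sdiff_ac)
qed

text \<open>The four sets sum to zero, so a dependency among three of them would make the fourth
  empty.\<close>

lemma no_associative_algebra_blade:
  assumes "B \<subseteq> {1..n}" "C \<subseteq> {1..n}" "D \<subseteq> {1..n}" "B \<triangle> C \<triangle> D \<noteq> {}" "B \<noteq> {}" "C \<noteq> {}" "D \<noteq> {}"
    and "s \<noteq> 0" "t \<noteq> 0" "u \<noteq> 0" "v \<noteq> 0"
  shows "no_associative_algebra (blade n s (B \<triangle> C \<triangle> D)) (blade n t B) (blade n u C) (blade n v D)"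
proof -
  have "B \<triangle> C \<triangle> D \<noteq> B \<triangle> C" "B \<triangle> C \<triangle> D \<noteq> B \<triangle> D" "B \<triangle> C \<triangle> D \<noteq> C \<triangle> D" "B \<noteq> C \<triangle> D"
    using assms(4-7) by (auto simp: sdiff_ac)
  then show ?thesis
    using assms form_associative_algebra_blade[of _ n] unfolding no_associative_algebra_def
    by (meson sdiff_subset)
qed

lemma add_eq_zero_iff:
  assumes "x \<in> cd_alg n" "y \<in> cd_alg n"
  shows "x + y = cd_zero n \<longleftrightarrow> x = - y"
proof -
  have "coeff n (cd_neg y) A = - coeff n y A" for A
  proof -
    have "coeff n (cd_neg x) A = - coeff n x A" if "x \<in> cd_alg n" for x n A
      using that by (induction n arbitrary: x A) auto
    then show ?thesis using assms by simp
  qed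
  then show ?thesis using assms
    by (auto simp: plus_cd_def uminus_cd_def cd_eq_iff_coeff[of _ n] coeff_add eq_neg_iff_add_eq_0[symmetric])
qed

lemma blade_mult_closed [simp]: "blade n r A * blade n s B \<in> cd_alg n"
  by (simp add: times_cd_def)

lemma zero_divisor_candidateE:
  assumes "zero_divisor_candidate n a b c d"
  obtains s t u v A B C D where
    "a = blade n s A" "b = blade n t B" "c = blade n u C" "d = blade n v D"
    "A \<subseteq> {1..n}" "B \<subseteq> {1..n}" "C \<subseteq> {1..n}" "D \<subseteq> {1..n}"
    "A \<noteq> {}" "B \<noteq> {}" "C \<noteq> {}" "D \<noteq> {}" "A \<noteq> B" "C \<noteq> D"
    "s \<in> {1, - 1}" "t \<in> {1, - 1}" "u \<in> {1, - 1}" "v \<in> {1, - 1}"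
proof -
  have "a \<in> pure_blades n" "b \<in> pure_blades n" "c \<in> pure_blades n" "d \<in> pure_blades n"
    using assms by (simp_all add: zero_divisor_candidate_def)
  then obtain s A t B u C v D where *:
    "s \<in> {1, - 1}" "A \<subseteq> {1..n}" "A \<noteq> {}" "a = blade n s A"
    "t \<in> {1, - 1}" "B \<subseteq> {1..n}" "B \<noteq> {}" "b = blade n t B"
    "u \<in> {1, - 1}" "C \<subseteq> {1..n}" "C \<noteq> {}" "c = blade n u C"
    "v \<in> {1, - 1}" "D \<subseteq> {1..n}" "D \<noteq> {}" "d = blade n v D"
    unfolding pure_blades_iff by (elim exE conjE)
  \<comment> \<open>Blades with the same index set are equal or opposite; distinctness excludes the
    first and the nonzero sum the second.\<close>
  have **: "A \<noteq> B" if "s \<in> {1, - 1}" "t \<in> {1, - 1}" "A \<subseteq> {1..n}" "B \<subseteq> {1..n}"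
    "blade n s A \<noteq> blade n t B" "blade n s A + blade n t B \<noteq> cd_zero n" for s t :: real and A B
  proof
    assume "A = B"
    then have "s \<noteq> t" "s \<noteq> - t"
      using that by (auto simp: plus_cd_def blade_sum_eq_zero_iff)
    then show False using that by auto
  qed
  have "a \<noteq> b" "c \<noteq> d" "a + b \<noteq> cd_zero n" "c + d \<noteq> cd_zero n"
    using assms by (simp_all add: zero_divisor_candidate_def)
  then have "A \<noteq> B" "C \<noteq> D"
    using **[of s t A B] **[of u v C D] * by simp_all
  with * show ?thesis by (intro that)
qed

text \<open>The third property is the sense in which the cross equation is an identity: it amounts
  to the choice of a as (bc)d.\<close>

lemma zero_divisor_candidate_properties:
  assumes "zero_divisor_candidate n a b c d"
  shows "(a + b) * (c + d) = cd_zero n \<longleftrightarrow> a * c + b * d = cd_zero n \<and> a * d + b * c = cd_zero n"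
    and "a * c + b * d = cd_zero n \<longleftrightarrow> a * c = - (b * d)"
    and "a = (b * c) * d \<longleftrightarrow> a * d + b * c = cd_zero n"
    and "a = (b * c) * d \<Longrightarrow> no_associative_algebra a b c d"
proof -
  obtain s t u v A B C D where *:
    "a = blade n s A" "b = blade n t B" "c = blade n u C" "d = blade n v D"
    and sub: "A \<subseteq> {1..n}" "B \<subseteq> {1..n}" "C \<subseteq> {1..n}" "D \<subseteq> {1..n}"
    and ne: "A \<noteq> {}" "B \<noteq> {}" "C \<noteq> {}" "D \<noteq> {}" "A \<noteq> B" "C \<noteq> D"
    and sgn: "s \<in> {1, - 1}" "t \<in> {1, - 1}" "u \<in> {1, - 1}" "v \<in> {1, - 1}"
    using assms by (rule zero_divisor_candidateE)
  have nz: "s \<noteq> 0" "t \<noteq> 0" "u \<noteq> 0" "v \<noteq> 0" using sgn by auto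
  show "(a + b) * (c + d) = cd_zero n \<longleftrightarrow> a * c + b * d = cd_zero n \<and> a * d + b * c = cd_zero n"
    unfolding * by (rule blade_product_eq_zero_iff) (use sub ne nz in auto)
  show "a * c + b * d = cd_zero n \<longleftrightarrow> a * c = - (b * d)"
    unfolding * by (rule add_eq_zero_iff) auto
  show "a = (b * c) * d \<longleftrightarrow> a * d + b * c = cd_zero n"
    unfolding * by (rule blade_eq_triple_product_iff) (use sub ne sgn in auto)
  assume "a = (b * c) * d"
  then have "A = B \<triangle> C \<triangle> D" using sub nz by (auto simp: * blade_mult blade_eq_iff)
  then show "no_associative_algebra a b c d"
    using no_associative_algebra_blade[of B n C D s t u v] sub ne nz by (simp add: *)
qed

section \<open>Associators and their relation to zero divisors\<close>

lemma associator_blade_eq_zero_iff: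
  assumes "A \<subseteq> {1..n}" "B \<subseteq> {1..n}" "C \<subseteq> {1..n}" "r \<noteq> 0" "s \<noteq> 0" "t \<noteq> 0"
  shows "associator (blade n r A) (blade n s B) (blade n t C) = cd_zero n \<longleftrightarrow> assoc_sign n A B C = 1"
  using assms mul_sign_cases[of n A B] mul_sign_cases[of n "A \<triangle> B" C] mul_sign_cases[of n B C]
    mul_sign_cases[of n A "B \<triangle> C"]
  by (auto simp: associator_def minus_cd_def blade_mult blade_sum_eq_zero_iff assoc_sign_def sdiff_assoc)

text \<open>One sign governs everything: the choice of a settles the cross equation, the parallel
  equation becomes a condition on \<open>assoc_sign n C B D\<close>, and the four associators of
  Type 3 belong to images of \<open>(C, B, D)\<close> under the dihedral symmetries.\<close>

lemma associated_zero_divisor: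
  assumes sub: "B \<subseteq> {1..n}" "C \<subseteq> {1..n}" "D \<subseteq> {1..n}"
    and ne: "B \<noteq> {}" "C \<noteq> {}" "D \<noteq> {}" "B \<noteq> C" "B \<noteq> D" "C \<noteq> D" "B \<triangle> C \<triangle> D \<noteq> {}"
    and def: "b = blade n 1 B" "c = blade n 1 C" "d = blade n 1 D" "a = (b * c) * d"
  shows "zero_divisor_pair n a b c d \<longleftrightarrow> a * c = - (b * d)"
    and "a * c = - (b * d) \<longleftrightarrow> assoc_sign n C B D = 1"
    and "type3_associative n b c d \<longleftrightarrow> assoc_sign n C B D = 1"
    and "(C, B, D) \<in> indep n"
    and "up_to_sign a = up_to_sign (blade n 1 (B \<triangle> C \<triangle> D))"
proof -
  define A where "A = B \<triangle> C \<triangle> D"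
  define s where "s = mul_sign n B C * mul_sign n (B \<triangle> C) D"
  have s: "s \<in> {1, - 1}"
    using mul_sign_cases[of n B C] mul_sign_cases[of n "B \<triangle> C" D] by (auto simp: s_def)
  have A: "A \<subseteq> {1..n}" unfolding A_def using sub by (intro sdiff_subset)
  have a: "a = blade n s A" using sub by (simp add: def blade_mult s_def A_def)
  have A_eqs: "A = B \<triangle> (C \<triangle> D)" "A = C \<triangle> (B \<triangle> D)" "A = D \<triangle> (B \<triangle> C)" "A = C \<triangle> B \<triangle> D"
    by (simp_all only: A_def sdiff_ac)
  have "A \<noteq> B" unfolding A_eqs(1) using ne by simp
  moreover have "A \<noteq> C" unfolding A_eqs(2) using ne by simp
  moreover have "A \<noteq> D" unfolding A_eqs(3) using ne by simp
  ultimately have A_ne: "A \<noteq> {}" "A \<noteq> B" "A \<noteq> C" "A \<noteq> D" using ne(7) by (simp_all add: A_def)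
  show ind: "(C, B, D) \<in> indep n"
  proof -
    have "C \<noteq> B \<triangle> D" using A_ne(1) by (metis A_eqs(2) sdiff_simps(1))
    then show ?thesis using sub ne by (simp add: indep_def)
  qed
  have s_nz: "s \<noteq> 0" using s by auto
  have cand: "zero_divisor_candidate n a b c d"
  proof -
    have "a \<in> pure_blades n" "b \<in> pure_blades n" "c \<in> pure_blades n" "d \<in> pure_blades n"
      unfolding pure_blades_iff a def(1-3) using A A_ne sub ne s by blast+
    moreover have "distinct [a, b, c, d]"
      using A_ne ne s_nz A sub by (simp add: a def(1-3) blade_eq_iff)
    moreover have "a + b \<noteq> cd_zero n" "c + d \<noteq> cd_zero n"
      using A_ne ne s_nz A sub by (simp_all add: a def(1-3) plus_cd_def blade_sum_eq_zero_iff)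
    moreover have "s * s = 1" using s by auto
    then have "a * a = b * b" "c * c = d * d"
      using A_ne ne A sub by (simp_all add: a def(1-3) blade_mult mul_sign_self)
    ultimately show ?thesis by (simp add: zero_divisor_candidate_def)
  qed
  note props = zero_divisor_candidate_properties[OF cand]
  show "zero_divisor_pair n a b c d \<longleftrightarrow> a * c = - (b * d)"
    using cand props(1,2,3) def(4) by (simp add: zero_divisor_pair_def)
  have AC: "A \<triangle> C = B \<triangle> D" by (simp only: A_def sdiff_ac) (simp add: sdiff_simps)
  show "a * c = - (b * d) \<longleftrightarrow> assoc_sign n C B D = 1"
  proof -
    \<comment> \<open>Alternativity and anticommutation turn the sign of ac into the last factor of
      \<open>assoc_sign n C B D\<close>; together with the sign \<open>s\<close> of (bc)d and the
      sign of bd all four factors are present.\<close>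
    have "mul_sign n C (C \<triangle> (B \<triangle> D)) = - mul_sign n C (B \<triangle> D)"
      using mul_sign_alternative[of C n "B \<triangle> D"] sub ne by simp
    then have "mul_sign n C A = - mul_sign n C (B \<triangle> D)" by (simp only: A_eqs(2))
    moreover have "mul_sign n A C = - mul_sign n C A"
      using A A_ne sub ne by (intro mul_sign_anticommute) auto
    ultimately have AC_sign: "mul_sign n A C = mul_sign n C (B \<triangle> D)" by simp
    have BC_sign: "mul_sign n B C = - mul_sign n C B"
      using sub ne by (intro mul_sign_anticommute) auto
    have "a * c = - (b * d) \<longleftrightarrow> s * mul_sign n A C = - mul_sign n B D"
      using A sub s_nz by (simp add: a def(1-3) blade_mult blade_eq_iff AC)
    also have "\<dots> \<longleftrightarrow> assoc_sign n C B D = 1"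
      unfolding s_def AC_sign BC_sign assoc_sign_def sdiff_commute[of B C]
      using mul_sign_cases[of n B D] by (elim disjE) (auto simp: algebra_simps)
    finally show ?thesis .
  qed
  show "type3_associative n b c d \<longleftrightarrow> assoc_sign n C B D = 1"
  proof -
    have "assoc_sign n C A D = assoc_sign n C B D"
      unfolding A_eqs(4) using ind by (rule assoc_sign_middle)
    moreover have "assoc_sign n A D B = assoc_sign n C B D"
      unfolding A_eqs(4) using ind by (rule assoc_sign_rotate)
    moreover have "assoc_sign n A C B = assoc_sign n C B D"
    proof -
      \<comment> \<open>This triple arises by rotating the reversed triple
        \<open>(D, B, C)\<close>.\<close>
      have "A = D \<triangle> B \<triangle> C" by (simp only: A_def sdiff_ac)
      then show ?thesis
        using assoc_sign_rotate[OF indep_symmetries(1)[OF ind]] assoc_sign_reverse[OF ind] by simp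
    qed
    ultimately show ?thesis
      using A sub s_nz associator_blade_eq_zero_iff[of _ n]
      by (simp add: type3_associative_def Let_def flip: def(4)) (simp add: a def(1-3))
  qed
  show "up_to_sign a = up_to_sign (blade n 1 (B \<triangle> C \<triangle> D))"
    using s by (auto simp: a A_def up_to_sign_def)
qed

text \<open>The cross equation forces a = (bc)d, so a zero divisor pair is determined by its
  positive b, c, d, and the parallel equation says that \<open>(C, B, D)\<close> associates. Passing
  to terms up to sign forgets only the sign of a, which is fixed by this product.\<close>

lemma zero_divisor_classes_eq:
  "{zero_divisor_class a b c d | a b c d. zero_divisor_pair n a b c d \<and> {b, c, d} \<subseteq> pure_basis n} =
     pairing (\<lambda>A. up_to_sign (blade n 1 A)) ` assoc_triples n"
proof (intro equalityI subsetI)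
  fix k assume "k \<in> {zero_divisor_class a b c d | a b c d.
    zero_divisor_pair n a b c d \<and> {b, c, d} \<subseteq> pure_basis n}"
  then obtain a b c d where k: "k = zero_divisor_class a b c d" and pair: "zero_divisor_pair n a b c d"
    and "b \<in> pure_basis n" "c \<in> pure_basis n" "d \<in> pure_basis n" by blast
  then obtain B C D where def: "b = blade n 1 B" "c = blade n 1 C" "d = blade n 1 D"
    and sub: "B \<subseteq> {1..n}" "C \<subseteq> {1..n}" "D \<subseteq> {1..n}" and ne: "B \<noteq> {}" "C \<noteq> {}" "D \<noteq> {}"
    unfolding pure_basis_iff by (elim exE conjE)
  have cand: "zero_divisor_candidate n a b c d" and "(a + b) * (c + d) = cd_zero n"
    using pair by (simp_all add: zero_divisor_pair_def)
  then have a: "a = (b * c) * d" using zero_divisor_candidate_properties by metis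
  have dist: "B \<noteq> C" "B \<noteq> D" "C \<noteq> D"
    using cand def by (auto simp: zero_divisor_candidate_def)
  have "a \<in> pure_blades n" using cand by (simp add: zero_divisor_candidate_def)
  \<comment> \<open>Otherwise (bc)d would be scalar, whereas a is pure.\<close>
  then have "B \<triangle> C \<triangle> D \<noteq> {}"
    unfolding pure_blades_iff using sub by (auto simp: a def blade_mult blade_eq_iff)
  note zd = associated_zero_divisor[OF sub ne dist this def a]
  have "(C, B, D) \<in> assoc_triples n" using zd pair by (simp add: assoc_triples_def)
  moreover have "k = pairing (\<lambda>A. up_to_sign (blade n 1 A)) (C, B, D)"
    using zd(5) by (simp add: k pairing_def zero_divisor_class_def def sdiff_commute[of C B])
  ultimately show "k \<in> pairing (\<lambda>A. up_to_sign (blade n 1 A)) ` assoc_triples n" by blast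
next
  fix k assume "k \<in> pairing (\<lambda>A. up_to_sign (blade n 1 A)) ` assoc_triples n"
  then obtain C B D where k: "k = pairing (\<lambda>A. up_to_sign (blade n 1 A)) (C, B, D)"
    and CBD: "(C, B, D) \<in> assoc_triples n" by auto
  then have sub: "B \<subseteq> {1..n}" "C \<subseteq> {1..n}" "D \<subseteq> {1..n}"
    and ne: "B \<noteq> {}" "C \<noteq> {}" "D \<noteq> {}" "B \<noteq> C" "B \<noteq> D" "C \<noteq> D" "C \<noteq> B \<triangle> D"
    by (auto simp: assoc_triples_def indep_def)
  have "B \<triangle> C \<triangle> D \<noteq> {}"
    using ne(7) by (metis sdiff_commute sdiff_assoc sdiff_eq_empty_iff)
  note zd = associated_zero_divisor[OF sub ne(1-6) this refl refl refl refl]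
  have "zero_divisor_pair n (blade n 1 B * blade n 1 C * blade n 1 D) (blade n 1 B) (blade n 1 C) (blade n 1 D)"
    using zd(1,2) CBD by (simp add: assoc_triples_def)
  moreover have "{blade n 1 B, blade n 1 C, blade n 1 D} \<subseteq> pure_basis n"
    using sub ne unfolding insert_subset pure_basis_iff by blast
  moreover have "k = zero_divisor_class (blade n 1 B * blade n 1 C * blade n 1 D) (blade n 1 B) (blade n 1 C) (blade n 1 D)"
    using zd(5) by (simp add: k pairing_def zero_divisor_class_def sdiff_commute[of C B])
  ultimately show "k \<in> {zero_divisor_class a b c d | a b c d.
    zero_divisor_pair n a b c d \<and> {b, c, d} \<subseteq> pure_basis n}" by blast
qed

lemma inj_on_up_to_sign_blade: "inj_on (\<lambda>A. up_to_sign (blade n 1 A)) (Pow {1..n})"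
  by (rule inj_onI) (auto simp: up_to_sign_def doubleton_eq_iff blade_eq_iff)

text \<open>Eight associating triples per class and four associating lifts per independent triple
  leave the factor 2.\<close>

lemma zero_divisor_count_Suc:
  "2 * real (zero_divisor_count (Suc n)) = (2 ^ n - 1) * (2 ^ n - 2) * (2 ^ n - 4)"
proof -
  have "8 * zero_divisor_count (Suc n) = 4 * card (indep n)"
    unfolding zero_divisor_count_def zero_divisor_classes_eq
      card_assoc_triples_Suc[symmetric]
    by (rule card_assoc_triples_pairing[OF inj_on_up_to_sign_blade, symmetric])
  then have "2 * real (zero_divisor_count (Suc n)) = real (card (indep n))" by linarith
  then show ?thesis by (simp only: card_indep)
qed

theorem theorem10:
  fixes m :: int and n :: nat
  assumes n_def: "int n = m + 3" and n_pos: "n > 0"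
  shows
    "(\<forall>a b c d. zero_divisor_candidate n a b c d \<longrightarrow>
        ((a + b) * (c + d) = cd_zero n \<longleftrightarrow>
           a * c + b * d = cd_zero n \<and> a * d + b * c = cd_zero n) \<and>
        ((a + b) * (c + d) = cd_zero n \<longrightarrow>
           a = (b * c) * d \<and> no_associative_algebra a b c d) \<and>
        (a = (b * c) * d \<and> no_associative_algebra a b c d \<longrightarrow>
           a * d + b * c = cd_zero n \<and>
           (zero_divisor_pair n a b c d \<longleftrightarrow> a * c = - (b * d)))) \<and>
     (\<forall>a b c d. {b, c, d} \<subseteq> pure_basis n \<and> distinct [b, c, d] \<and>
        a = (b * c) * d \<and> a \<notin> range (cd_scalar n) \<longrightarrow>
        (zero_divisor_pair n a b c d \<longleftrightarrow> a * c = - (b * d)) \<and>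
        (a * c = - (b * d) \<longleftrightarrow> type3_associative n b c d)) \<and>
     real (ultronion_Z m) =
       1 / 16 * (real (ultronion_N m) - 1) * (real (ultronion_N m) - 3) * (real (ultronion_N m) - 7)"
proof (intro conjI)
  show "\<forall>a b c d. zero_divisor_candidate n a b c d \<longrightarrow>
        ((a + b) * (c + d) = cd_zero n \<longleftrightarrow>
           a * c + b * d = cd_zero n \<and> a * d + b * c = cd_zero n) \<and>
        ((a + b) * (c + d) = cd_zero n \<longrightarrow>
           a = (b * c) * d \<and> no_associative_algebra a b c d) \<and>
        (a = (b * c) * d \<and> no_associative_algebra a b c d \<longrightarrow>
           a * d + b * c = cd_zero n \<and>
           (zero_divisor_pair n a b c d \<longleftrightarrow> a * c = - (b * d)))"
  proof (intro allI impI)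
    fix a b c d assume cand: "zero_divisor_candidate n a b c d"
    note props = zero_divisor_candidate_properties[OF cand]
    show "((a + b) * (c + d) = cd_zero n \<longleftrightarrow>
           a * c + b * d = cd_zero n \<and> a * d + b * c = cd_zero n) \<and>
        ((a + b) * (c + d) = cd_zero n \<longrightarrow>
           a = (b * c) * d \<and> no_associative_algebra a b c d) \<and>
        (a = (b * c) * d \<and> no_associative_algebra a b c d \<longrightarrow>
           a * d + b * c = cd_zero n \<and>
           (zero_divisor_pair n a b c d \<longleftrightarrow> a * c = - (b * d)))"
      using props cand unfolding zero_divisor_pair_def by blast
  qed
  show "\<forall>a b c d. {b, c, d} \<subseteq> pure_basis n \<and> distinct [b, c, d] \<and>
        a = (b * c) * d \<and> a \<notin> range (cd_scalar n) \<longrightarrow>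
        (zero_divisor_pair n a b c d \<longleftrightarrow> a * c = - (b * d)) \<and>
        (a * c = - (b * d) \<longleftrightarrow> type3_associative n b c d)"
  proof (intro allI impI)
    fix a b c d
    assume *: "{b, c, d} \<subseteq> pure_basis n \<and> distinct [b, c, d] \<and>
        a = (b * c) * d \<and> a \<notin> range (cd_scalar n)"
    then have a: "a = (b * c) * d"
      and "b \<in> pure_basis n" "c \<in> pure_basis n" "d \<in> pure_basis n" by simp_all
    then obtain B C D where def: "b = blade n 1 B" "c = blade n 1 C" "d = blade n 1 D"
      and sub: "B \<subseteq> {1..n}" "C \<subseteq> {1..n}" "D \<subseteq> {1..n}" and ne: "B \<noteq> {}" "C \<noteq> {}" "D \<noteq> {}"
      unfolding pure_basis_iff by (elim exE conjE)
    have dist: "B \<noteq> C" "B \<noteq> D" "C \<noteq> D" using * def by auto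
    \<comment> \<open>An empty sum of indices would make a a real multiple of 1.\<close>
    have "B \<triangle> C \<triangle> D \<noteq> {}"
    proof
      assume "B \<triangle> C \<triangle> D = {}"
      then have "a = cd_scalar n (mul_sign n B C * mul_sign n (B \<triangle> C) D)"
        using sub unfolding cd_scalar_eq_blade a def by (simp add: blade_mult del: sdiff_eq_empty_iff)
      then show False using * by blast
    qed
    note zd = associated_zero_divisor[OF sub ne dist this def a]
    show "(zero_divisor_pair n a b c d \<longleftrightarrow> a * c = - (b * d)) \<and>
        (a * c = - (b * d) \<longleftrightarrow> type3_associative n b c d)"
      using zd by blast
  qed
  \<comment> \<open>With n = k + 1 the factors N - 1, N - 3 and N - 7 are twice 2^k - 1, 2^k - 2 and
    2^k - 4, so 1/16 becomes 1/2.\<close>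
  obtain k where k: "n = Suc k" using n_pos gr0_implies_Suc by blast
  have Z: "ultronion_Z m = zero_divisor_count (Suc k)" and N: "real (ultronion_N m) = 2 * 2 ^ k - 1"
    using n_def by (simp_all add: ultronion_Z_def ultronion_N_def of_nat_diff k[symmetric] flip: n_def power_Suc)
  show "real (ultronion_Z m) =
       1 / 16 * (real (ultronion_N m) - 1) * (real (ultronion_N m) - 3) * (real (ultronion_N m) - 7)"
    using zero_divisor_count_Suc[of k] unfolding Z N by (simp add: field_simps)
qed

end
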